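(* Let $N\ge3$, $q>1$ and $\lambda,\theta\in\mathbb R$ be such that $\lambda\le\lambda_H$ and $\theta_-\le\theta\le\theta_+$. Then the problem $$-\Delta u-\frac{\lambda}{|x|^2}u+|x|^\theta u^q=0\ \text{ in }\mathbb R^N\setminus\{0\},\qquad u>0\ \text{ in }\mathbb R^N\setminus\{0\},$$ has no solutions.
   Context: Notation: $\lambda_H:=(N-2)^2/4$, $p_\pm:=\frac{N-2}{2}\pm\sqrt{\lambda_H-\lambda}$ and $\theta_\pm:=p_\pm(q-1)-2$. A solution is a positive function $u\in C^1(\mathbb R^N\setminus\{0\})$ such that for every $\varphi\in C^1_c(\mathbb R^N\setminus\{0\})$, $$\int\nabla u\cdot\nabla\varphi\,dx-\int\frac{\lambda}{|x|^2}u\,\varphi\,dx+\int|x|^\theta u^q\varphi\,dx=0,$$ the integrals being over $\mathbb R^N$. *)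

theory Defs
  imports "HOL-Analysis.Analysis"
begin

definition lambda_H :: "nat \<Rightarrow> real" where
  "lambda_H N = (real N - 2)\<^sup>2 / 4"

definition p_plus :: "nat \<Rightarrow> real \<Rightarrow> real" where
  "p_plus N lam = (real N - 2) / 2 + sqrt (lambda_H N - lam)"

definition p_minus :: "nat \<Rightarrow> real \<Rightarrow> real" where
  "p_minus N lam = (real N - 2) / 2 - sqrt (lambda_H N - lam)"

definition theta_plus :: "nat \<Rightarrow> real \<Rightarrow> real \<Rightarrow> real" where
  "theta_plus N lam q = p_plus N lam * (q - 1) - 2"

definition theta_minus :: "nat \<Rightarrow> real \<Rightarrow> real \<Rightarrow> real" where
  "theta_minus N lam q = p_minus N lam * (q - 1) - 2"

text \<open>The gradient is a junk value at points where the function is not differentiable;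
  it is only used for functions that are continuously differentiable away from the origin.\<close>

definition grad :: "(real ^ 'n \<Rightarrow> real) \<Rightarrow> real ^ 'n \<Rightarrow> real ^ 'n" where
  "grad u x = (THE D. GDERIV u x :> D)"

definition C1_on :: "(real ^ 'n) set \<Rightarrow> (real ^ 'n \<Rightarrow> real) \<Rightarrow> bool" where
  "C1_on S u \<longleftrightarrow> (\<forall>x\<in>S. u differentiable (at x)) \<and> continuous_on S (grad u)"

text \<open>Functions on an open set \<open>S\<close> are represented by total functions. For a test function
  the support condition forces the value \<open>0\<close> off \<open>S\<close>, i.e. the extension by zero is taken.\<close>

definition C1c_on :: "(real ^ 'n) set \<Rightarrow> (real ^ 'n \<Rightarrow> real) \<Rightarrow> bool" where
  "C1c_on S \<phi> \<longleftrightarrow>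
     C1_on S \<phi> \<and> compact (closure {x. \<phi> x \<noteq> 0}) \<and> closure {x. \<phi> x \<noteq> 0} \<subseteq> S"

text \<open>The value of \<open>u\<close> at the origin is irrelevant: every test function vanishes near
  the origin, and so does its gradient. Hence, for such \<open>u\<close> and \<open>\<phi>\<close>, all three integrands
  are continuous with compact support in the punctured space, and the integrals are genuine.\<close>

definition is_solution :: "real \<Rightarrow> real \<Rightarrow> real \<Rightarrow> (real ^ 'n \<Rightarrow> real) \<Rightarrow> bool" where
  "is_solution lam \<theta> q u \<longleftrightarrow>
     C1_on (- {0}) u \<and> (\<forall>x\<in>- {0}. u x > 0) \<and>
     (\<forall>\<phi>. C1c_on (- {0}) \<phi> \<longrightarrow>
        (\<integral>x. grad u x \<bullet> grad \<phi> x \<partial>lborel)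
        - (\<integral>x. lam / (norm x)\<^sup>2 * u x * \<phi> x \<partial>lborel)
        + (\<integral>x. norm x powr \<theta> * u x powr q * \<phi> x \<partial>lborel) = 0)"

end

(* In the Emden-Fowler variables u = |x|^(-beta) v, t = ln |x| with beta = (theta + 2) / (q - 1), the
   condition theta_- <= theta <= theta_+ says p_- <= beta <= p_+, so the zeroth-order coefficient
   c = (N - 2) beta - beta^2 - lambda of the transformed equation
   v_tt + (N - 2 - 2 beta) v_t + Delta_S v = c v + v^q is nonnegative and the comparison principle
   holds for it. Following Keller and Osserman, v is compared on e^(-R) < |x| < e^R with a function
   of t that blows up at t = -R and t = R; as R tends to infinity this bound at t = 0 tends to 0,
   contradicting v > 0. Since u is only a weak C^1 solution, the comparison is done by testing
   with |x|^(-beta) times the square of the positive part of v - zeta. *)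

theory Submission
  imports Defs
begin

section \<open>Integrals of compactly supported functions\<close>

lemma integrable_continuous_compact_support:
  fixes f :: "'a::euclidean_space \<Rightarrow> real"
  assumes "compact K" "continuous_on K f" "\<And>x. x \<notin> K \<Longrightarrow> f x = 0"
  shows "integrable lborel f"
proof -
  have "(\<lambda>x. indicator K x *\<^sub>R f x) = f"
    using assms(3) by (auto simp: indicator_def fun_eq_iff)
  with borel_integrable_compact[OF assms(1,2)] show ?thesis by simp
qed

text \<open>The hypotheses make \<open>f\<close> vanish almost everywhere, while continuity makes
  the part of \<open>A\<close> where \<open>f\<close> is nonzero open; an open negligible set is
  empty. This turns the integrated comparison into a pointwise one.\<close>

lemma nonneg_integral_zero_imp_zero:
  fixes f :: "'a::euclidean_space \<Rightarrow> real"
  assumes int: "integrable lborel f" and nonneg: "\<And>x. 0 \<le> f x"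
    and zero: "integral\<^sup>L lborel f = 0"
    and A: "open A" "continuous_on A f" "x \<in> A"
  shows "f x = 0"
proof (rule ccontr)
  assume fx: "f x \<noteq> 0"
  have "AE x in lborel. f x = 0"
    using integral_nonneg_eq_0_iff_AE[OF int] nonneg zero by auto
  moreover have "{x \<in> space lborel. f x \<noteq> 0} \<in> sets lborel"
    using int by measurable
  ultimately have "{x. f x \<noteq> 0} \<in> null_sets lborel"
    using AE_iff_null_sets[of "{x. f x \<noteq> 0}" lborel] by simp
  then have neg: "negligible {x. f x \<noteq> 0}"
    using negligible_iff_null_sets null_sets_completionI by blast
  have "open {x \<in> A. f x \<in> - {0}}"
    using continuous_open_preimage[OF A(2,1), of "- {0}"]
    by (auto simp: vimage_def Int_def)
  moreover have "{x \<in> A. f x \<in> - {0}} \<noteq> {}" using fx A(3) by auto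
  moreover have "negligible {x \<in> A. f x \<in> - {0}}"
    by (rule negligible_subset[OF neg]) auto
  ultimately show False using open_not_negligible by blast
qed

text \<open>Translation invariance makes the integrals of the difference quotients vanish.\<close>

lemma integral_gradient_compact_support_eq_0:
  fixes f :: "'a::euclidean_space \<Rightarrow> real"
  assumes deriv: "\<And>x. GDERIV f x :> g x" and cont: "continuous_on UNIV g"
    and K: "compact K" "\<And>x. x \<notin> K \<Longrightarrow> f x = 0" "\<And>x. x \<notin> K \<Longrightarrow> g x = 0"
  shows "(\<integral>x. g x \<bullet> b \<partial>lborel) = 0"
proof -
  have contf: "continuous_on UNIV f"
    using deriv unfolding gderiv_def
    by (intro has_derivative_continuous_on) (auto intro: has_derivative_at_withinI)
  have intf: "integrable lborel f"
    by (rule integrable_continuous_compact_support[OF K(1) continuous_on_subset[OF contf] K(2)]) auto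
  have bm: "f \<in> borel_measurable lborel" using intf by auto
  have "bounded (g ` K)"
    using K(1) cont continuous_on_subset compact_continuous_image compact_imp_bounded by blast
  then obtain M0 where M0: "\<And>x. x \<in> K \<Longrightarrow> norm (g x) \<le> M0"
    by (auto simp: bounded_iff)
  define M where "M = max 0 M0"
  have M: "norm (g x) \<le> M" "0 \<le> M" for x
    using M0[of x] K(3)[of x] by (cases "x \<in> K"; auto simp: M_def)+
  \<comment> \<open>A global Lipschitz bound yields a majorant for the difference quotients that is
    independent of \<open>n\<close>.\<close>
  have lip: "norm (f y - f x) \<le> M * norm (y - x)" for x y
  proof (rule differentiable_bound[OF convex_UNIV])
    show "(f has_derivative (\<lambda>h. h \<bullet> g x)) (at x within UNIV)" for x
      using deriv by (simp add: gderiv_def)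
    show "onorm (\<lambda>h. h \<bullet> g x) \<le> M" for x
    proof (rule onorm_le)
      fix h show "norm (h \<bullet> g x) \<le> M * norm h"
        using Cauchy_Schwarz_ineq2[of h "g x"] mult_left_mono[OF M(1)[of x], of "norm h"]
        by (simp add: mult.commute)
    qed
  qed auto
  obtain r where r: "\<And>x. x \<in> K \<Longrightarrow> norm x \<le> r"
    using compact_imp_bounded[OF K(1)] by (auto simp: bounded_iff)
  \<comment> \<open>\<open>s n\<close> is the difference quotient in direction \<open>b\<close> with
    step \<open>1 / Suc n\<close>. Each shift has length at most \<open>norm b\<close>, so
    \<open>s n\<close> vanishes outside the ball of radius \<open>r + norm b\<close>, and inside it
    the Lipschitz bound gives \<open>M * norm b\<close>.\<close>
  define s where "s n x = real (Suc n) * (f (x + (1 / real (Suc n)) *\<^sub>R b) - f x)" for n x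
  define w where "w x = indicator (cball 0 (r + norm b)) x *\<^sub>R (M * norm b)" for x :: 'a
  have shift_int: "integrable lborel (\<lambda>x. f (x + c)) \<and> (\<integral>x. f (x + c) \<partial>lborel) = integral\<^sup>L lborel f" for c
  proof -
    have "integrable (distr lborel borel ((+) c)) f" using intf by (simp add: lborel_distr_plus)
    then have 1: "integrable lborel (\<lambda>x. f (c + x))" by (subst (asm) integrable_distr_eq) (use bm in auto)
    have "integral\<^sup>L (distr lborel borel ((+) c)) f = (\<integral>x. f (c + x) \<partial>lborel)"
      by (rule integral_distr) (use bm in auto)
    with 1 show ?thesis by (simp add: lborel_distr_plus add.commute)
  qed
  have s0: "integral\<^sup>L lborel (s n) = 0" for n
    unfolding s_def using shift_int intf by simp
  have "(\<lambda>n. integral\<^sup>L lborel (s n)) \<longlonglongrightarrow> (\<integral>x. g x \<bullet> b \<partial>lborel)"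
  proof (rule integral_dominated_convergence[where w = w])
    show "(\<lambda>x. g x \<bullet> b) \<in> borel_measurable lborel"
      using borel_measurable_continuous_onI[OF cont] by measurable
    show "s n \<in> borel_measurable lborel" for n
      unfolding s_def using shift_int intf by measurable
    show "integrable lborel w" unfolding w_def
      by (rule borel_integrable_compact) auto
    show "AE x in lborel. norm (s n x) \<le> w x" for n
    proof (rule AE_I2)
      fix x
      have nb: "norm ((1 / real (Suc n)) *\<^sub>R b) \<le> norm b"
        by (simp add: divide_le_eq mult_le_cancel_left1)
      show "norm (s n x) \<le> w x"
      proof (cases "x \<in> cball 0 (r + norm b)")
        case True
        have "norm (s n x) = real (Suc n) * norm (f (x + (1 / real (Suc n)) *\<^sub>R b) - f x)"
          by (simp add: s_def abs_mult)
        also have "\<dots> \<le> real (Suc n) * (M * norm ((x + (1 / real (Suc n)) *\<^sub>R b) - x))"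
          by (intro mult_left_mono lip) auto
        also have "\<dots> = M * norm b" by simp
        finally show ?thesis using True by (simp add: w_def)
      next
        case False
        then have "norm x > r + norm b" by simp
        moreover have "norm x \<le> norm (x + (1 / real (Suc n)) *\<^sub>R b) + norm ((1 / real (Suc n)) *\<^sub>R b)"
          using norm_triangle_ineq4[of "x + (1 / real (Suc n)) *\<^sub>R b" "(1 / real (Suc n)) *\<^sub>R b"] by simp
        ultimately have "x \<notin> K" "x + (1 / real (Suc n)) *\<^sub>R b \<notin> K"
          using r nb norm_ge_zero[of b] by (smt (verit))+
        then show ?thesis using False K(2) by (simp add: s_def w_def)
      qed
    qed
    show "AE x in lborel. (\<lambda>n. s n x) \<longlonglongrightarrow> g x \<bullet> b"
    proof (rule AE_I2)
      fix x
      have "((\<lambda>h::real. f (x + h *\<^sub>R b)) has_derivative (\<lambda>h. (h *\<^sub>R b) \<bullet> g x)) (at 0)"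
        by (rule has_derivative_compose[where g = f])
           (use deriv[of x] in \<open>auto simp: gderiv_def intro!: derivative_eq_intros\<close>)
      then have "((\<lambda>h::real. f (x + h *\<^sub>R b)) has_real_derivative g x \<bullet> b) (at 0)"
        by (simp add: has_field_derivative_def inner_commute mult_commute_abs)
      then have lim: "((\<lambda>h. (f (x + h *\<^sub>R b) - f x) / h) \<longlongrightarrow> g x \<bullet> b) (at 0)"
        by (simp add: DERIV_def)
      have "filterlim (\<lambda>n. 1 / real (Suc n)) (at 0) sequentially"
        unfolding filterlim_at using LIMSEQ_Suc[OF lim_1_over_n] by (auto intro!: always_eventually)
      from filterlim_compose[OF lim this] show "(\<lambda>n. s n x) \<longlonglongrightarrow> g x \<bullet> b"
        by (simp add: s_def mult.commute)
    qed
  qed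
  then have "(\<lambda>n. 0) \<longlonglongrightarrow> (\<integral>x. g x \<bullet> b \<partial>lborel)" by (simp only: s0)
  then show ?thesis by (simp add: LIMSEQ_const_iff)
qed

text \<open>The integrand is the divergence of the field f(x) x: it sums, over the basis vectors
  \<open>b\<close>, the derivatives of \<open>f x * (x \<bullet> b)\<close> in direction
  \<open>b\<close>, and each of these integrates to zero.\<close>

lemma integral_radial_divergence_eq_0:
  fixes f :: "'a::euclidean_space \<Rightarrow> real"
  assumes deriv: "\<And>x. GDERIV f x :> g x" and cont: "continuous_on UNIV g"
    and K: "compact K" "\<And>x. x \<notin> K \<Longrightarrow> f x = 0" "\<And>x. x \<notin> K \<Longrightarrow> g x = 0"
  shows "(\<integral>x. real DIM('a) * f x + g x \<bullet> x \<partial>lborel) = 0"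
proof -
  have contf: "continuous_on UNIV f"
    using deriv unfolding gderiv_def
    by (intro has_derivative_continuous_on) (auto intro: has_derivative_at_withinI)
  define G where "G b x = (x \<bullet> b) *\<^sub>R g x + f x *\<^sub>R b" for b x
  have contG: "continuous_on UNIV (G b)" for b
    unfolding G_def by (intro continuous_intros cont contf)
  have zero: "(\<integral>x. G b x \<bullet> b \<partial>lborel) = 0" for b
  proof (rule integral_gradient_compact_support_eq_0[where f = "\<lambda>x. f x * (x \<bullet> b)" and K = K])
    show "GDERIV (\<lambda>x. f x * (x \<bullet> b)) x :> G b x" for x
    proof -
      have "GDERIV (\<lambda>x. x \<bullet> b) x :> b"
        by (auto simp: gderiv_def intro!: derivative_eq_intros)
      from GDERIV_mult[OF deriv this] show ?thesis by (simp add: G_def add.commute)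
    qed
  qed (use contG K in \<open>auto simp: G_def\<close>)
  have int: "integrable lborel (\<lambda>x. G b x \<bullet> b)" for b
    by (rule integrable_continuous_compact_support[OF K(1)])
       (use K in \<open>auto intro!: continuous_intros continuous_on_subset[OF cont] continuous_on_subset[OF contf] simp: G_def\<close>)
  have "real DIM('a) * f x + g x \<bullet> x = (\<Sum>b\<in>Basis. G b x \<bullet> b)" for x
  proof -
    have "(\<Sum>b\<in>Basis. G b x \<bullet> b) = (\<Sum>b\<in>Basis. (x \<bullet> b) * (g x \<bullet> b)) + (\<Sum>b\<in>(Basis::'a set). f x)"
      by (simp add: G_def inner_add_left sum.distrib inner_Basis)
    then show ?thesis by (simp add: euclidean_inner[of "g x" x] mult.commute)
  qed
  then have "(\<integral>x. real DIM('a) * f x + g x \<bullet> x \<partial>lborel) = (\<integral>x. (\<Sum>b\<in>Basis. G b x \<bullet> b) \<partial>lborel)"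
    by simp
  also have "\<dots> = 0" by (subst Bochner_Integration.integral_sum) (use int zero in auto)
  finally show ?thesis .
qed

section \<open>Gradients and extension by zero\<close>

lemma GDERIV_unique:
  assumes "GDERIV f x :> D" "GDERIV f x :> E"
  shows "D = E"
proof -
  have "(\<lambda>h. h \<bullet> D) = (\<lambda>h. h \<bullet> E)"
    using assms has_derivative_unique unfolding gderiv_def by blast
  then have "(D - E) \<bullet> (D - E) = 0"
    by (metis inner_diff_right right_minus_eq)
  then show ?thesis by simp
qed

lemma grad_eq: "GDERIV f x :> D \<Longrightarrow> grad f x = D"
  unfolding grad_def using GDERIV_unique by blast

text \<open>Ensures that the definite description in \<open>grad\<close> is met:
  \<open>adjoint f' 1\<close> represents the derivative \<open>f'\<close>, and the representing
  vector is unique.\<close>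

lemma GDERIV_grad:
  fixes f :: "real ^ 'n \<Rightarrow> real"
  assumes "f differentiable (at x)"
  shows "GDERIV f x :> grad f x"
proof -
  obtain f' where f': "(f has_derivative f') (at x)"
    using assms by (auto simp: differentiable_def)
  have lin: "linear f'" using f' by (rule has_derivative_linear)
  have "f' h = h \<bullet> adjoint f' 1" for h
    using adjoint_works[OF lin, of h 1] by simp
  then have "GDERIV f x :> adjoint f' 1"
    using f' unfolding gderiv_def by (metis (no_types, lifting) ext)
  then show ?thesis using grad_eq by metis
qed

text \<open>The open sets \<open>A\<close> and \<open>- K\<close> cover the space. On
  \<open>A\<close> the extension is locally \<open>f\<close>, off \<open>K\<close> it is locally
  zero, and on the overlap uniqueness of gradients forces \<open>g\<close> to vanish.\<close>

lemma GDERIV_extend_zero: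
  assumes A: "open A" and K: "compact K" "K \<subseteq> A"
    and deriv: "\<And>x. x \<in> A \<Longrightarrow> GDERIV f x :> g x"
    and zero: "\<And>x. x \<in> A - K \<Longrightarrow> f x = 0"
  shows "GDERIV (\<lambda>x. if x \<in> A then f x else 0) x :> (if x \<in> A then g x else 0)"
proof -
  let ?F = "\<lambda>x. if x \<in> A then f x else 0"
  have inA: "GDERIV ?F x :> g x" if "x \<in> A" for x
    using deriv[OF that] unfolding gderiv_def
    by (rule has_derivative_transform_within_open[OF _ A that]) auto
  have offK: "GDERIV ?F x :> 0" if "x \<notin> K" for x
    unfolding gderiv_def inner_zero_right
    by (rule has_derivative_transform_within_open[where s = "- K" and f = "\<lambda>_. 0"])
       (use that K(1) zero compact_imp_closed in auto)
  have "g x = 0" if "x \<in> A" "x \<notin> K"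
    using GDERIV_unique[OF inA offK] that by blast
  then show "GDERIV ?F x :> (if x \<in> A then g x else 0)"
    using inA offK K(2) by (cases "x \<in> A") auto
qed

lemma continuous_on_extend_zero:
  fixes g :: "'a::t2_space \<Rightarrow> 'b::real_normed_vector"
  assumes A: "open A" and K: "compact K" "K \<subseteq> A"
    and cont: "continuous_on A g" and zero: "\<And>x. x \<in> A - K \<Longrightarrow> g x = 0"
  shows "continuous_on UNIV (\<lambda>x. if x \<in> A then g x else 0)"
proof -
  let ?G = "\<lambda>x. if x \<in> A then g x else 0"
  have "continuous_on (A \<union> - K) ?G"
  proof (rule continuous_on_open_Un)
    show "continuous_on A ?G" using cont by (rule continuous_on_eq) auto
    show "continuous_on (- K) ?G"
      by (rule continuous_on_eq[where f = "\<lambda>_. 0"]) (use zero in auto)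
  qed (use A K compact_imp_closed in auto)
  moreover have "A \<union> - K = UNIV" using K(2) by auto
  ultimately show ?thesis by simp
qed

section \<open>A blow-up barrier in one variable\<close>

text \<open>A positive supersolution of z'' + a z' = z^q on (-R, R) that tends to infinity at both
  ends. Continuity of \<open>\<zeta>2\<close> serves to make the gradient of the flux
  continuous.\<close>

definition barrier :: "real \<Rightarrow> real \<Rightarrow> real \<Rightarrow> (real \<Rightarrow> real) \<Rightarrow> (real \<Rightarrow> real) \<Rightarrow> (real \<Rightarrow> real) \<Rightarrow> bool" where
  "barrier a q R \<zeta> \<zeta>1 \<zeta>2 \<longleftrightarrow> R > 0 \<and>
     (\<forall>t. \<bar>t\<bar> < R \<longrightarrow> (\<zeta> has_real_derivative \<zeta>1 t) (at t) \<and> (\<zeta>1 has_real_derivative \<zeta>2 t) (at t) \<and>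
        \<zeta> t > 0 \<and> \<zeta>2 t + a * \<zeta>1 t \<le> \<zeta> t powr q) \<and>
     continuous_on {-R<..<R} \<zeta>2 \<and>
     (\<forall>M. \<exists>R'<R. \<forall>t. R' < \<bar>t\<bar> \<and> \<bar>t\<bar> < R \<longrightarrow> \<zeta> t > M)"

text \<open>The barrier is \<open>\<zeta> t = K * (R^2 - t^2) powr (-k)\<close> with \<open>k = 2 / (q - 1)\<close>. The friction term
  makes \<open>K powr (q - 1)\<close> of order \<open>R^3\<close> and hence \<open>\<zeta> 0\<close> of order \<open>R powr (-k/2)\<close>.\<close>

lemma barrier_exists:
  assumes q: "q > 1" and \<delta>: "\<delta> > 0"
  shows "\<exists>R \<zeta> \<zeta>1 \<zeta>2. barrier a q R \<zeta> \<zeta>1 \<zeta>2 \<and> \<zeta> 0 < \<delta>"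
proof -
  \<comment> \<open>Since \<open>k * q = k + 2\<close>, both \<open>\<zeta> powr q\<close> and
    \<open>\<zeta>2\<close> have the leading singularity (R^2 - t^2)^(-k-2).\<close>
  define k where "k = 2 / (q - 1)"
  have k: "k > 0" "k * q = k + 2" using q by (auto simp: k_def field_simps)
  \<comment> \<open>The three summands bound the two terms of \<open>\<zeta>2\<close> and the
    friction term \<open>a * \<zeta>1\<close>, once K R^3 (R^2 - t^2)^(-k-2) is factored
    out.\<close>
  define C where "C = 2*k + 4*k*(k+1) + \<bar>a\<bar>*2*k"
  have C: "C > 0" using k by (auto simp: C_def intro!: add_pos_nonneg)
  \<comment> \<open>With \<open>K\<close> as below, \<open>\<zeta> 0 powr (q - 1)\<close> equals
    \<open>C / R\<close>, which has to drop below \<open>\<delta> powr (q - 1)\<close>; the factor 2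
    makes this strict. The bound R \<ge> 1 gives R^2 \<le> R^3.\<close>
  define R where "R = max 1 (2 * C / \<delta> powr (q - 1))"
  have R: "R \<ge> 1" "C / R < \<delta> powr (q - 1)"
  proof -
    show "R \<ge> 1" by (simp add: R_def)
    have "2 * C / \<delta> powr (q - 1) \<le> R" by (simp add: R_def)
    then have "2 * C \<le> R * \<delta> powr (q - 1)" using \<delta> by (simp add: field_simps)
    then have "C < R * \<delta> powr (q - 1)" using C by linarith
    then show "C / R < \<delta> powr (q - 1)" using \<open>R \<ge> 1\<close> by (simp add: field_simps)
  qed
  define K where "K = (C * R^3) powr (1 / (q - 1))"
  have K: "K > 0" using C R by (simp add: K_def)
  have Kq: "K powr q = K * (C * R^3)"
  proof -
    have "K powr q = K powr 1 * K powr (q - 1)"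
      using powr_add[of K 1 "q - 1"] by simp
    also have "K powr (q - 1) = C * R^3" using C R q by (simp add: K_def powr_powr)
    finally show ?thesis using K by simp
  qed
  define \<zeta> where "\<zeta> t = K * (R\<^sup>2 - t\<^sup>2) powr (-k)" for t
  define \<zeta>1 where "\<zeta>1 t = 2*k*K*t * (R\<^sup>2 - t\<^sup>2) powr (-k-1)" for t
  define \<zeta>2 where "\<zeta>2 t = 2*k*K * (R\<^sup>2 - t\<^sup>2) powr (-k-1) + 4*k*(k+1)*K*t\<^sup>2 * (R\<^sup>2 - t\<^sup>2) powr (-k-2)" for t
  have pos: "R\<^sup>2 - t\<^sup>2 > 0" if "\<bar>t\<bar> < R" for t
    using power_strict_mono[OF that, of 2] by simp
  have d0: "(\<zeta> has_real_derivative \<zeta>1 t) (at t)" if "\<bar>t\<bar> < R" for t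
    unfolding \<zeta>_def \<zeta>1_def using pos[OF that]
    by (auto intro!: derivative_eq_intros simp: field_simps)
  have d1: "(\<zeta>1 has_real_derivative \<zeta>2 t) (at t)" if "\<bar>t\<bar> < R" for t
  proof -
    have e: "-k-1-1 = -k-2" by simp
    show ?thesis unfolding \<zeta>1_def \<zeta>2_def using pos[OF that]
      by (auto intro!: derivative_eq_intros simp: e power2_eq_square algebra_simps)
  qed
  have sup: "\<zeta>2 t + a * \<zeta>1 t \<le> \<zeta> t powr q" if t: "\<bar>t\<bar> < R" for t
  proof -
    define s where "s = R\<^sup>2 - t\<^sup>2"
    have s: "s > 0" "s \<le> R\<^sup>2" using pos[OF t] by (auto simp: s_def)
    define E where "E = s powr (-k-2)"
    have E: "E > 0" using s by (simp add: E_def)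
    have p1: "s powr (-k-1) = s * E"
    proof -
      have "s powr (-k-1) = s powr 1 * s powr (-k-2)"
        unfolding powr_add[symmetric] by (rule arg_cong[of _ _ "(powr) s"]) simp
      also have "s powr 1 = s" using s by simp
      finally show ?thesis by (simp only: E_def)
    qed
    have "\<zeta> t powr q = K powr q * s powr (-k * q)"
      using K s by (simp add: \<zeta>_def powr_mult powr_powr s_def)
    also have "- k * q = -k-2" using k by simp
    finally have zq: "\<zeta> t powr q = K * E * (C * R^3)" by (simp add: Kq E_def)
    have RR: "R\<^sup>2 \<le> R^3" using R by (simp add: power_increasing)
    have t2: "t\<^sup>2 \<le> R\<^sup>2" using s by (simp add: s_def)
    have ats: "a * t * s \<le> \<bar>a\<bar> * R^3"
    proof -
      have "a * t * s \<le> \<bar>a * t\<bar> * s" using s by (intro mult_right_mono) auto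
      also have "\<dots> = \<bar>a\<bar> * (\<bar>t\<bar> * s)" by (simp add: abs_mult)
      also have "\<bar>t\<bar> * s \<le> R * R\<^sup>2" using t s by (intro mult_mono) auto
      finally show ?thesis by (simp add: mult_left_mono power3_eq_cube power2_eq_square mult.assoc)
    qed
    have "\<zeta>2 t + a * \<zeta>1 t = K * E * (2*k * s + 4*k*(k+1)*t\<^sup>2 + 2*k*(a * t * s))"
      unfolding \<zeta>1_def \<zeta>2_def s_def[symmetric] p1 by (simp add: E_def algebra_simps)
    also have "\<dots> \<le> K * E * (2*k*R^3 + 4*k*(k+1)*R^3 + 2*k*(\<bar>a\<bar>*R^3))"
      using K E k s t2 RR ats by (intro mult_left_mono add_mono) auto
    also have "\<dots> = \<zeta> t powr q" unfolding zq C_def by (simp add: algebra_simps)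
    finally show ?thesis .
  qed
  have cont: "continuous_on {-R<..<R} \<zeta>2"
  proof -
    have "R\<^sup>2 - t\<^sup>2 \<noteq> 0" if "t \<in> {-R<..<R}" for t using pos[of t] that by (simp add: abs_less_iff)
    then show ?thesis unfolding \<zeta>2_def by (intro continuous_intros) auto
  qed
  have blow: "\<exists>R'<R. \<forall>t. R' < \<bar>t\<bar> \<and> \<bar>t\<bar> < R \<longrightarrow> \<zeta> t > M" for M
  proof -
    \<comment> \<open>\<open>m\<close> solves K m^(-k) = |M| + 1. Within distance m / (2 R) of an
      endpoint, R^2 - t^2 = (R - |t|) (R + |t|) is less than \<open>m\<close>.\<close>
    define m where "m = (K / (\<bar>M\<bar> + 1)) powr (1/k)"
    have m: "m > 0" using K by (simp add: m_def)
    show ?thesis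
    proof (intro exI[of _ "max 0 (R - m / (2*R))"] conjI allI impI)
      show "max 0 (R - m / (2*R)) < R" using R m by simp
      fix t assume "max 0 (R - m / (2*R)) < \<bar>t\<bar> \<and> \<bar>t\<bar> < R"
      then have t: "\<bar>t\<bar> < R" "R - \<bar>t\<bar> < m / (2*R)" by auto
      have "R\<^sup>2 - t\<^sup>2 = (R - \<bar>t\<bar>) * (R + \<bar>t\<bar>)" by (simp add: algebra_simps power2_eq_square flip: abs_mult)
      also have "\<dots> < m / (2*R) * (2*R)" using t R by (intro mult_strict_mono) auto
      finally have "R\<^sup>2 - t\<^sup>2 < m" using R by simp
      then have "m powr (-k) < (R\<^sup>2 - t\<^sup>2) powr (-k)"
        using pos[OF t(1)] k by (intro powr_less_mono2_neg) auto
      moreover have "m powr (-k) = (\<bar>M\<bar> + 1) / K"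
        using K k by (simp add: m_def powr_powr powr_minus_divide)
      ultimately have "\<bar>M\<bar> + 1 < \<zeta> t" using K by (simp add: \<zeta>_def field_simps)
      then show "\<zeta> t > M" by linarith
    qed
  qed
  have small: "\<zeta> 0 < \<delta>"
  proof -
    have "\<zeta> 0 powr (q - 1) = K powr (q - 1) * (R\<^sup>2) powr (-k * (q - 1))"
      using K R by (simp add: \<zeta>_def powr_mult powr_powr)
    also have "K powr (q - 1) = C * R^3" using C R q by (simp add: K_def powr_powr)
    also have "-k * (q - 1) = - 2" using q by (simp add: k_def field_simps)
    also have "(R\<^sup>2) powr (- 2) = 1 / R^4" using R by (simp add: powr_minus_divide)
    also have "C * R^3 * (1 / R^4) = C / R" using R by (simp add: power3_eq_cube power4_eq_xxxx)
    finally have "\<zeta> 0 powr (q - 1) < \<delta> powr (q - 1)" using R by simp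
    then show ?thesis using q \<delta> by (meson diff_gt_0_iff_gt less_imp_le not_le powr_mono2)
  qed
  have "\<zeta> t > 0" if "\<bar>t\<bar> < R" for t
    using pos[OF that] K by (simp add: \<zeta>_def)
  then have "barrier a q R \<zeta> \<zeta>1 \<zeta>2"
    unfolding barrier_def using R d0 d1 sup cont blow by auto
  with small show ?thesis by blast
qed

section \<open>Radial chain rules, the squared positive part and the flux\<close>

lemma GDERIV_radial:
  fixes x :: "'a::real_inner"
  assumes "x \<noteq> 0" and "(f has_real_derivative D) (at (ln (norm x)))"
  shows "GDERIV (\<lambda>x. f (ln (norm x))) x :> (D / (norm x)\<^sup>2) *\<^sub>R x"
proof -
  have "((\<lambda>r. f (ln r)) has_real_derivative D * (1 / norm x)) (at (norm x))"
    using assms by (intro DERIV_chain2[where f = f]) (auto intro!: derivative_eq_intros)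
  from GDERIV_DERIV_compose[OF GDERIV_norm[OF assms(1)] this] show ?thesis
    by (simp add: sgn_div_norm power2_eq_square divide_inverse mult.assoc)
qed

lemma GDERIV_norm_powr:
  fixes x :: "'a::real_inner"
  assumes "x \<noteq> 0"
  shows "GDERIV (\<lambda>x. norm x powr s) x :> (s * norm x powr s / (norm x)\<^sup>2) *\<^sub>R x"
proof -
  have "((\<lambda>r. r powr s) has_real_derivative s * norm x powr (s - 1)) (at (norm x))"
    using assms by (auto intro!: derivative_eq_intros)
  from GDERIV_DERIV_compose[OF GDERIV_norm[OF assms(1)] this] show ?thesis
    using assms by (simp add: sgn_div_norm power2_eq_square divide_inverse mult.assoc powr_diff)
qed

text \<open>At the kink the difference quotient is at most |h| in absolute value. The positive part
  itself is not differentiable there; its square is C^1 and so can enter a C^1 test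
  function.\<close>

lemma DERIV_pos_part_square:
  "((\<lambda>s::real. (max 0 s)\<^sup>2) has_real_derivative 2 * max 0 s) (at s)"
proof -
  consider "s < 0" | "s > 0" | "s = 0" by linarith
  then show ?thesis
  proof cases
    case 1
    have "((\<lambda>s::real. 0) has_real_derivative 2 * max 0 s) (at s)" using 1 by simp
    then show ?thesis
      by (rule has_field_derivative_transform_within_open[where S = "{..<0}"]) (use 1 in auto)
  next
    case 2
    have "((\<lambda>s::real. s\<^sup>2) has_real_derivative 2 * max 0 s) (at s)"
      using 2 by (auto intro!: derivative_eq_intros)
    then show ?thesis
      by (rule has_field_derivative_transform_within_open[where S = "{0<..}"]) (use 2 in auto)
  next
    case 3
    have "((\<lambda>h::real. (max 0 h)\<^sup>2 / h) \<longlongrightarrow> 0) (at 0)"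
    proof (rule Lim_null_comparison)
      show "\<forall>\<^sub>F h::real in at 0. norm ((max 0 h)\<^sup>2 / h) \<le> \<bar>h\<bar>"
        by (intro always_eventually allI) (auto simp: max_def power2_eq_square)
    qed (auto intro!: tendsto_eq_intros)
    then show ?thesis using 3 by (simp add: DERIV_def)
  qed
qed

text \<open>The flux \<open>\<Phi> x\<close> is chosen so that its divergence removes all the first-order terms of
  \<open>\<nabla>u \<cdot> \<nabla>\<phi>\<close> except a square; here \<open>P = |x|\<^sup>\<beta>\<close>, \<open>u = v / P\<close>, \<open>\<phi> = \<psi> / P\<close> and \<open>V = \<nabla>v\<close>.\<close>

lemma flux_identity:
  fixes x V :: "'a::real_inner" and r P \<beta> v z1 z2 \<psi> D n :: real
  assumes r: "r = norm x" "r > 0" and P: "P > 0"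
  defines "Z \<equiv> V - (z1 / r\<^sup>2) *\<^sub>R x"
  defines "g\<phi> \<equiv> (1 / P) *\<^sub>R (D *\<^sub>R Z) + \<psi> *\<^sub>R ((- \<beta> * (1 / P) / r\<^sup>2) *\<^sub>R x)"
  defines "Q \<equiv> 1 / (P\<^sup>2 * r\<^sup>2)"
  defines "\<Phi> \<equiv> Q * (\<psi> * (z1 - \<beta> * v))"
  defines "g\<Phi> \<equiv> Q *\<^sub>R (\<psi> *\<^sub>R ((z2 / r\<^sup>2) *\<^sub>R x - \<beta> *\<^sub>R V) + (z1 - \<beta> * v) *\<^sub>R (D *\<^sub>R Z))
                 + (\<psi> * (z1 - \<beta> * v)) *\<^sub>R (((- 2 * \<beta> - 2) * Q / r\<^sup>2) *\<^sub>R x)"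
  assumes gu: "V = P *\<^sub>R gu + (v / P) *\<^sub>R ((\<beta> * P / r\<^sup>2) *\<^sub>R x)"
  shows "gu \<bullet> g\<phi> - (n * \<Phi> + g\<Phi> \<bullet> x) =
    Q * (D * r\<^sup>2 * (norm Z)\<^sup>2 + \<psi> * (((n - 2) * \<beta> - \<beta>\<^sup>2) * v - (n - 2 - 2 * \<beta>) * z1 - z2))"
proof -
  \<comment> \<open>The product rule for v = P u, solved for the gradient of u.\<close>
  have gu': "gu = (1 / P) *\<^sub>R (V - (\<beta> * v / r\<^sup>2) *\<^sub>R x)"
    using P by (simp add: gu algebra_simps)
  have xx: "x \<bullet> x = r\<^sup>2" using r by (simp add: power2_norm_eq_inner)
  \<comment> \<open>Besides \<open>x \<bullet> x\<close>, every inner product reduces to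
    \<open>p\<close> and \<open>W\<close>, so the identity becomes scalar algebra.\<close>
  define p W where "p = V \<bullet> x" and "W = V \<bullet> V"
  have px: "x \<bullet> V = p" by (simp add: p_def inner_commute)
  have Zx: "Z \<bullet> x = p - z1" "x \<bullet> Z = p - z1"
    using r by (auto simp: Z_def inner_diff_left inner_diff_right xx px p_def)
  have VZ: "V \<bullet> Z = W - z1 * p / r\<^sup>2"
    using r by (auto simp: Z_def inner_diff_right W_def p_def)
  have ZZ: "(norm Z)\<^sup>2 = W - 2 * z1 * p / r\<^sup>2 + z1\<^sup>2 / r\<^sup>2"
    using r unfolding power2_norm_eq_inner Z_def
    by (simp add: inner_diff_right inner_diff_left xx px flip: W_def p_def)
       (simp add: field_simps power2_eq_square)
  have 1: "gu \<bullet> g\<phi> = 1 / P\<^sup>2 * (D * (W - z1 * p / r\<^sup>2) - \<psi> * \<beta> / r\<^sup>2 * p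
      - \<beta> * v / r\<^sup>2 * (D * (p - z1) - \<psi> * \<beta>))"
    using r P unfolding gu' g\<phi>_def
    by (simp add: inner_diff_right inner_diff_left inner_add_left inner_add_right xx px Zx VZ flip: p_def)
       (simp add: field_simps power2_eq_square)
  have 2: "g\<Phi> \<bullet> x = Q * (\<psi> * (z2 - \<beta> * p) + (z1 - \<beta> * v) * (D * (p - z1))
      + \<psi> * (z1 - \<beta> * v) * (- 2 * \<beta> - 2))"
    using r unfolding g\<Phi>_def
    by (simp add: inner_diff_right inner_diff_left inner_add_left inner_add_right xx px Zx flip: p_def)
       (simp add: field_simps power2_eq_square)
  have Q: "1 / P\<^sup>2 = Q * r\<^sup>2" using r by (simp add: Q_def)
  have r0: "r\<^sup>2 * (y / r\<^sup>2) = y" for y using r by simp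
  have 3: "gu \<bullet> g\<phi> = Q * (D * (r\<^sup>2 * W - z1 * p) - \<psi> * \<beta> * p - \<beta> * v * (D * (p - z1) - \<psi> * \<beta>))"
    unfolding 1 Q using r by (simp add: field_simps)
  have 4: "r\<^sup>2 * (norm Z)\<^sup>2 = r\<^sup>2 * W - 2 * z1 * p + z1\<^sup>2"
    unfolding ZZ using r by (simp add: field_simps)
  have 5: "D * r\<^sup>2 * (norm Z)\<^sup>2 = D * (r\<^sup>2 * W - 2 * z1 * p + z1\<^sup>2)"
    using 4 by simp
  show ?thesis unfolding 3 2 5 \<Phi>_def by (simp add: algebra_simps power2_eq_square)
qed

section \<open>Comparison with the barrier on an annulus\<close>

text \<open>Because \<open>\<zeta>\<close> blows up, the excess \<open>d\<close> of |x|^\<beta> u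
  over the barrier is positive only inside a compact part of the annulus, which makes the weighted
  square of its positive part an admissible test function. Subtracting a divergence of zero integral
  from the weak equation leaves an integrand that is nonnegative, and positive wherever
  \<open>d\<close> is positive.\<close>

lemma subsolution_le_barrier:
  fixes u :: "real ^ 'n \<Rightarrow> real"
  assumes sol: "is_solution lam \<theta> q u" and q: "q > 1" and \<beta>: "\<beta> * (q - 1) = \<theta> + 2"
    and lam: "lam \<le> (real CARD('n) - 2) * \<beta> - \<beta>\<^sup>2"
    and bar: "barrier (real CARD('n) - 2 - 2 * \<beta>) q R \<zeta> \<zeta>1 \<zeta>2"
    and x0: "exp (- R) < norm x0" "norm x0 < exp R"
  shows "norm x0 powr \<beta> * u x0 \<le> \<zeta> (ln (norm x0))"
proof -
  define n where "n = real CARD('n)"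
  define A :: "(real ^ 'n) set" where "A = {x. exp (- R) < norm x \<and> norm x < exp R}"
  define t where "t x = ln (norm x)" for x :: "real ^ 'n"
  define v where "v x = norm x powr \<beta> * u x" for x
  define d where "d x = v x - \<zeta> (t x)" for x
  define \<psi> where "\<psi> x = (max 0 (d x))\<^sup>2" for x
  define V where "V x = norm x powr \<beta> *\<^sub>R grad u x + u x *\<^sub>R ((\<beta> * norm x powr \<beta> / (norm x)\<^sup>2) *\<^sub>R x)" for x
  define Z where "Z x = V x - (\<zeta>1 (t x) / (norm x)\<^sup>2) *\<^sub>R x" for x
  define \<phi> where "\<phi> x = norm x powr (- \<beta>) * \<psi> x" for x
  define g\<phi> where "g\<phi> x = norm x powr (- \<beta>) *\<^sub>R ((2 * max 0 (d x)) *\<^sub>R Z x)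
      + \<psi> x *\<^sub>R ((- \<beta> * norm x powr (- \<beta>) / (norm x)\<^sup>2) *\<^sub>R x)" for x
  \<comment> \<open>\<open>Q\<close>, \<open>\<Phi>\<close> and the two gradients are written in the
    shape of \<open>flux_identity\<close>, with r = |x|, P = |x|^\<beta> and
    \<open>D = 2 * max 0 (d x)\<close>.\<close>
  define Q where "Q x = norm x powr (- 2 * \<beta> - 2)" for x :: "real ^ 'n"
  define \<Phi> where "\<Phi> x = Q x * (\<psi> x * (\<zeta>1 (t x) - \<beta> * v x))" for x
  define g\<Phi> where "g\<Phi> x = Q x *\<^sub>R (\<psi> x *\<^sub>R ((\<zeta>2 (t x) / (norm x)\<^sup>2) *\<^sub>R x - \<beta> *\<^sub>R V x)
        + (\<zeta>1 (t x) - \<beta> * v x) *\<^sub>R ((2 * max 0 (d x)) *\<^sub>R Z x))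
      + (\<psi> x * (\<zeta>1 (t x) - \<beta> * v x)) *\<^sub>R (((- 2 * \<beta> - 2) * Q x / (norm x)\<^sup>2) *\<^sub>R x)" for x
  note R = bar[unfolded barrier_def, THEN conjunct1]
  have \<zeta>: "(\<zeta> has_real_derivative \<zeta>1 s) (at s)" "(\<zeta>1 has_real_derivative \<zeta>2 s) (at s)" "\<zeta> s > 0"
    "\<zeta>2 s + (n - 2 - 2 * \<beta>) * \<zeta>1 s \<le> \<zeta> s powr q" if "\<bar>s\<bar> < R" for s
    using bar that by (auto simp: barrier_def n_def)
  have A0: "x \<noteq> 0" "norm x > 0" if "x \<in> A" for x
    using that exp_gt_zero[of "-R"] by (auto simp: A_def)
  have tR: "\<bar>t x\<bar> < R" if "x \<in> A" for x
  proof -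
    have "ln (exp (-R)) < ln (norm x)" "ln (norm x) < ln (exp R)"
      using that A0[OF that] by (subst ln_less_cancel_iff; auto simp: A_def)+
    then show ?thesis by (simp add: t_def abs_less_iff)
  qed
  have "open A" unfolding A_def by (intro open_Collect_conj open_Collect_less continuous_intros)
  have udiff: "u differentiable (at x)" and upos: "u x > 0" if "x \<noteq> 0" for x
    using sol that by (auto simp: is_solution_def C1_on_def)
  have gu: "GDERIV u x :> grad u x" if "x \<noteq> 0" for x
    using GDERIV_grad udiff that by blast
  have contu: "continuous_on S u" if "0 \<notin> S" for S
    using that udiff
    by (intro continuous_at_imp_continuous_on) (metis differentiable_imp_continuous_within)
  have contgu: "continuous_on A (grad u)"
    using sol A0(1) by (auto simp: is_solution_def C1_on_def intro: continuous_on_subset)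
  have nA: "0 \<notin> A" using A0(1) by blast

  \<comment> \<open>On the closed annulus \<open>v\<close> is bounded by some \<open>M\<close>, as
    \<open>u\<close> is continuous away from the origin; \<open>\<zeta>\<close> exceeds
    \<open>M\<close> as soon as |t| > R', and \<open>K\<close> is the set |t| \<le> R'. A negative
    R' just makes \<open>K\<close> empty.\<close>
  obtain K where K: "compact K" "K \<subseteq> A" "\<And>x. x \<in> A - K \<Longrightarrow> d x \<le> 0"
  proof -
    define B :: "(real ^ 'n) set" where "B = {x. exp (- R) \<le> norm x \<and> norm x \<le> exp R}"
    have "0 \<notin> B" by (simp add: B_def)
    have "closed B" unfolding B_def by (intro closed_Collect_conj closed_Collect_le continuous_intros)
    moreover have "bounded B" by (auto simp: B_def bounded_iff)
    ultimately have "compact B" by (simp add: compact_eq_bounded_closed)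
    moreover have "continuous_on B v"
      unfolding v_def using \<open>0 \<notin> B\<close> by (auto intro!: continuous_intros contu)
    ultimately have "bounded (v ` B)" using compact_continuous_image compact_imp_bounded by blast
    then obtain M where M: "\<And>x. x \<in> B \<Longrightarrow> v x \<le> M" unfolding bounded_iff by (metis abs_le_D1 image_eqI real_norm_def)
    obtain R' where R': "R' < R" "\<And>s. R' < \<bar>s\<bar> \<Longrightarrow> \<bar>s\<bar> < R \<Longrightarrow> \<zeta> s > M"
      using bar unfolding barrier_def by meson
    define K :: "(real ^ 'n) set" where "K = {x. exp (- R') \<le> norm x \<and> norm x \<le> exp R'}"
    show thesis
    proof (rule that)
      have "closed K" unfolding K_def by (intro closed_Collect_conj closed_Collect_le continuous_intros)
      moreover have "bounded K" by (auto simp: K_def bounded_iff)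
      ultimately show "compact K" by (simp add: compact_eq_bounded_closed)
      show "K \<subseteq> A"
      proof
        fix x assume "x \<in> K"
        moreover have "exp (- R) < exp (- R')" "exp R' < exp R" using R' by auto
        ultimately show "x \<in> A"
          unfolding K_def A_def mem_Collect_eq by (meson less_le_trans le_less_trans)
      qed
      fix x assume x: "x \<in> A - K"
      have "R' < \<bar>t x\<bar>"
      proof (rule ccontr)
        assume "\<not> R' < \<bar>t x\<bar>"
        then have "exp (- R') \<le> exp (t x)" "exp (t x) \<le> exp R'" by (auto simp: abs_le_iff)
        moreover have "exp (t x) = norm x" using x A0[of x] by (simp add: t_def)
        ultimately show False using x by (simp add: K_def)
      qed
      then have "\<zeta> (t x) > M" using R' tR x by auto
      moreover have "x \<in> B" using x by (auto simp: A_def B_def)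
      ultimately show "d x \<le> 0" using M by (force simp: d_def)
    qed
  qed
  have \<psi>0: "\<psi> x = 0" "max 0 (d x) = 0" if "x \<in> A - K" for x
    using K(3)[OF that] by (auto simp: \<psi>_def)

  have Gv: "GDERIV v x :> V x" if "x \<in> A" for x
    unfolding v_def V_def by (intro GDERIV_mult GDERIV_norm_powr gu A0 that)
  have G\<zeta>: "GDERIV (\<lambda>x. \<zeta> (t x)) x :> (\<zeta>1 (t x) / (norm x)\<^sup>2) *\<^sub>R x" if "x \<in> A" for x
    unfolding t_def using \<zeta>(1)[OF tR[OF that]] A0[OF that] by (intro GDERIV_radial) (auto simp: t_def)
  have G\<zeta>1: "GDERIV (\<lambda>x. \<zeta>1 (t x)) x :> (\<zeta>2 (t x) / (norm x)\<^sup>2) *\<^sub>R x" if "x \<in> A" for x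
    unfolding t_def using \<zeta>(2)[OF tR[OF that]] A0[OF that] by (intro GDERIV_radial) (auto simp: t_def)
  have Gd: "GDERIV d x :> Z x" if "x \<in> A" for x
    unfolding d_def Z_def by (intro GDERIV_diff Gv G\<zeta> that)
  have G\<psi>: "GDERIV \<psi> x :> (2 * max 0 (d x)) *\<^sub>R Z x" if "x \<in> A" for x
    unfolding \<psi>_def by (rule GDERIV_DERIV_compose[OF Gd[OF that] DERIV_pos_part_square])
  have G\<phi>: "GDERIV \<phi> x :> g\<phi> x" if "x \<in> A" for x
    unfolding \<phi>_def g\<phi>_def by (intro GDERIV_mult GDERIV_norm_powr G\<psi> A0 that)
  have G\<beta>v: "GDERIV (\<lambda>x. \<beta> * v x) x :> \<beta> *\<^sub>R V x" if "x \<in> A" for x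
    using GDERIV_mult[OF GDERIV_const Gv[OF that], of \<beta>] by simp
  have G\<Phi>: "GDERIV \<Phi> x :> g\<Phi> x" if "x \<in> A" for x
    unfolding \<Phi>_def g\<Phi>_def Q_def
    by (intro GDERIV_mult GDERIV_diff GDERIV_norm_powr G\<psi> G\<zeta>1 G\<beta>v A0 that)

  have ct: "continuous_on A t" unfolding t_def using nA by (auto intro!: continuous_intros)
  have tA: "t ` A \<subseteq> {-R<..<R}" using tR by (force simp: abs_less_iff)
  have c\<zeta>: "continuous_on A (\<lambda>x. \<zeta> (t x))" "continuous_on A (\<lambda>x. \<zeta>1 (t x))" "continuous_on A (\<lambda>x. \<zeta>2 (t x))"
  proof -
    have "continuous_on {-R<..<R} \<zeta>" "continuous_on {-R<..<R} \<zeta>1"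
      by (rule DERIV_continuous_on, rule has_field_derivative_at_within, rule \<zeta>, simp add: abs_less_iff)+
    moreover have "continuous_on {-R<..<R} \<zeta>2" using bar by (simp add: barrier_def)
    ultimately show "continuous_on A (\<lambda>x. \<zeta> (t x))" "continuous_on A (\<lambda>x. \<zeta>1 (t x))" "continuous_on A (\<lambda>x. \<zeta>2 (t x))"
      using ct tA by (auto intro: continuous_on_compose2)
  qed
  have cp: "continuous_on A (\<lambda>x. norm x powr s)" for s
    using nA by (auto intro!: continuous_intros)
  have ci: "continuous_on A (\<lambda>x. f x / (norm x)\<^sup>2)" if "continuous_on A f" for f
    using nA that by (auto intro!: continuous_intros)
  have cv: "continuous_on A v" unfolding v_def by (intro continuous_intros cp contu nA)
  have cV: "continuous_on A V" unfolding V_def by (intro continuous_intros cp ci contu nA contgu)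
  have cZ: "continuous_on A Z" unfolding Z_def by (intro continuous_intros ci cV c\<zeta>)
  have cd: "continuous_on A d" unfolding d_def by (intro continuous_intros cv c\<zeta>)
  have cm: "continuous_on A (\<lambda>x. max 0 (d x))" by (intro continuous_intros cd)
  have c\<psi>: "continuous_on A \<psi>" unfolding \<psi>_def by (intro continuous_intros cm)
  have c\<phi>: "continuous_on A \<phi>" unfolding \<phi>_def by (intro continuous_intros cp c\<psi>)
  have cg\<phi>: "continuous_on A g\<phi>" unfolding g\<phi>_def by (intro continuous_intros cp ci c\<psi> cZ cm)
  have cQ: "continuous_on A Q" unfolding Q_def by (rule cp)
  have c\<Phi>: "continuous_on A \<Phi>" unfolding \<Phi>_def by (intro continuous_intros cQ c\<psi> c\<zeta> cv)
  have cg\<Phi>: "continuous_on A g\<Phi>" unfolding g\<Phi>_def by (intro continuous_intros cQ ci c\<psi> c\<zeta> cv cV cZ cm)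

  \<comment> \<open>Nothing is known about the barrier functions outside \<open>A\<close>, so all
    formulas are replaced by zero there; on \<open>A - K\<close> they vanish already.\<close>
  define ext where "ext f x = (if x \<in> A then f x else 0)" for f :: "real ^ 'n \<Rightarrow> real" and x
  define extv where "extv f x = (if x \<in> A then f x else 0)" for f :: "real ^ 'n \<Rightarrow> real ^ 'n" and x
  have \<phi>0: "\<phi> x = 0" and \<Phi>0: "\<Phi> x = 0" if "x \<in> A - K" for x
    using \<psi>0[OF that] by (auto simp: \<phi>_def \<Phi>_def)
  have g\<phi>0: "g\<phi> x = 0" and g\<Phi>0: "g\<Phi> x = 0" if "x \<in> A - K" for x
    using \<psi>0[OF that] by (auto simp: g\<phi>_def g\<Phi>_def)
  have e\<phi>: "GDERIV (ext \<phi>) x :> extv g\<phi> x" for x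
    unfolding ext_def extv_def by (rule GDERIV_extend_zero[OF \<open>open A\<close> K(1,2) G\<phi> \<phi>0])
  have e\<Phi>: "GDERIV (ext \<Phi>) x :> extv g\<Phi> x" for x
    unfolding ext_def extv_def by (rule GDERIV_extend_zero[OF \<open>open A\<close> K(1,2) G\<Phi> \<Phi>0])
  have ce\<phi>: "continuous_on UNIV (extv g\<phi>)"
    unfolding extv_def by (rule continuous_on_extend_zero[OF \<open>open A\<close> K(1,2) cg\<phi> g\<phi>0])
  have ce\<Phi>: "continuous_on UNIV (extv g\<Phi>)"
    unfolding extv_def by (rule continuous_on_extend_zero[OF \<open>open A\<close> K(1,2) cg\<Phi> g\<Phi>0])
  have grad\<phi>: "grad (ext \<phi>) = extv g\<phi>" using grad_eq[OF e\<phi>] by auto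
  have int: "integrable lborel (ext T)" if "continuous_on A T" "\<And>x. x \<in> A - K \<Longrightarrow> T x = 0" for T
  proof (rule integrable_continuous_compact_support[OF K(1)])
    show "continuous_on K (ext T)"
      by (rule continuous_on_eq[OF continuous_on_subset[OF that(1) K(2)]]) (use K(2) in \<open>auto simp: ext_def\<close>)
  qed (use that(2) in \<open>auto simp: ext_def\<close>)

  have "C1c_on (- {0}) (ext \<phi>)"
  proof -
    have "closure {x. ext \<phi> x \<noteq> 0} \<subseteq> K"
      by (rule closure_minimal) (use \<phi>0 K(1) compact_imp_closed in \<open>auto simp: ext_def\<close>)
    moreover from this have "compact (closure {x. ext \<phi> x \<noteq> 0})"
      using K(1) closed_closure compact_Int_closed inf.absorb_iff2 by metis
    moreover have "ext \<phi> differentiable (at x)" for x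
      using e\<phi>[of x] unfolding gderiv_def differentiable_def by blast
    ultimately show ?thesis
      unfolding C1c_on_def C1_on_def grad\<phi> using K(2) nA continuous_on_subset[OF ce\<phi>] by auto
  qed
  then have weak: "(\<integral>x. grad u x \<bullet> extv g\<phi> x \<partial>lborel)
      - (\<integral>x. lam / (norm x)\<^sup>2 * u x * ext \<phi> x \<partial>lborel)
      + (\<integral>x. norm x powr \<theta> * u x powr q * ext \<phi> x \<partial>lborel) = 0"
    using sol unfolding is_solution_def grad\<phi>[symmetric] by blast
  define T1 where "T1 x = grad u x \<bullet> g\<phi> x" for x
  define T2 where "T2 x = lam / (norm x)\<^sup>2 * u x * \<phi> x" for x
  define T3 where "T3 x = norm x powr \<theta> * u x powr q * \<phi> x" for x
  \<comment> \<open>The divergence of the field \<Phi>(x) x, as \<open>n\<close> is the dimension.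
    Its integral is zero, so it may be subtracted from the weak equation.\<close>
  define T4 where "T4 x = n * \<Phi> x + g\<Phi> x \<bullet> x" for x
  define T where "T x = T1 x - T2 x + T3 x - T4 x" for x
  have cT: "continuous_on A T1" "continuous_on A T2" "continuous_on A T3" "continuous_on A T4"
    unfolding T1_def T2_def T3_def T4_def using upos A0(1)
    by (intro continuous_intros contgu cg\<phi> ci contu nA c\<phi> cp c\<Phi> cg\<Phi>; force)+
  have T0: "T1 x = 0" "T2 x = 0" "T3 x = 0" "T4 x = 0" if "x \<in> A - K" for x
    using \<phi>0[OF that] \<Phi>0[OF that] g\<phi>0[OF that] g\<Phi>0[OF that] by (auto simp: T1_def T2_def T3_def T4_def)
  have iT: "integrable lborel (ext T1)" "integrable lborel (ext T2)" "integrable lborel (ext T3)"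
    "integrable lborel (ext T4)"
    using int cT T0 by blast+
  have eT: "ext T = (\<lambda>x. ext T1 x - ext T2 x + ext T3 x - ext T4 x)"
    by (auto simp: ext_def T_def)
  have "integral\<^sup>L lborel (ext T4) = 0"
  proof -
    have "(\<integral>x. real DIM(real ^ 'n) * ext \<Phi> x + extv g\<Phi> x \<bullet> x \<partial>lborel) = 0"
    proof (rule integral_radial_divergence_eq_0[OF e\<Phi> ce\<Phi> K(1)])
      show "ext \<Phi> x = 0" "extv g\<Phi> x = 0" if "x \<notin> K" for x
        using that \<Phi>0 g\<Phi>0 by (auto simp: ext_def extv_def)
    qed
    moreover have "(\<lambda>x. real DIM(real ^ 'n) * ext \<Phi> x + extv g\<Phi> x \<bullet> x) = ext T4"
      by (auto simp: ext_def extv_def T4_def n_def)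
    ultimately show ?thesis by simp
  qed
  moreover have "(\<lambda>x. grad u x \<bullet> extv g\<phi> x) = ext T1"
    "(\<lambda>x. lam / (norm x)\<^sup>2 * u x * ext \<phi> x) = ext T2"
    "(\<lambda>x. norm x powr \<theta> * u x powr q * ext \<phi> x) = ext T3"
    by (auto simp: ext_def extv_def T1_def T2_def T3_def)
  ultimately have zero: "integral\<^sup>L lborel (ext T) = 0"
    using weak iT unfolding eT by simp

  \<comment> \<open>\<open>flux_identity\<close> evaluates \<open>T1 - T4\<close>; the potential and
    the nonlinearity carry the same weight \<open>Q\<close>. The gradient of \<open>v\<close>
    survives only in the square of \<open>norm (Z x)\<close>.\<close>
  have T_eq: "T x = Q x * (2 * max 0 (d x) * (norm x)\<^sup>2 * (norm (Z x))\<^sup>2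
      + \<psi> x * (((n - 2) * \<beta> - \<beta>\<^sup>2 - lam) * v x + v x powr q - (n - 2 - 2 * \<beta>) * \<zeta>1 (t x) - \<zeta>2 (t x)))"
    if x: "x \<in> A" for x
  proof -
    define r P where "r = norm x" and "P = r powr \<beta>"
    have r: "r > 0" using A0[OF x] by (simp add: r_def)
    then have P: "P > 0" by (simp add: P_def)
    have P': "r powr (- \<beta>) = 1 / P" by (simp add: P_def powr_minus_divide)
    have Q': "Q x = 1 / (P\<^sup>2 * r\<^sup>2)"
    proof -
      have "r powr (- 2 * \<beta> - 2) = 1 / (r powr (\<beta> + \<beta> + 2))"
        by (simp flip: powr_minus_divide)
      also have "r powr (\<beta> + \<beta> + 2) = P\<^sup>2 * r\<^sup>2"
        unfolding powr_add P_def using r by (simp only: powr_numeral power2_eq_square)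
      finally show ?thesis by (simp add: Q_def r_def)
    qed
    have vP: "v x = P * u x" by (simp add: v_def P_def r_def)
    have 14: "T1 x - T4 x = Q x * (2 * max 0 (d x) * r\<^sup>2 * (norm (Z x))\<^sup>2
      + \<psi> x * (((n - 2) * \<beta> - \<beta>\<^sup>2) * v x - (n - 2 - 2 * \<beta>) * \<zeta>1 (t x) - \<zeta>2 (t x)))"
    proof -
      have V': "V x = P *\<^sub>R grad u x + (v x / P) *\<^sub>R ((\<beta> * P / r\<^sup>2) *\<^sub>R x)"
        using P by (simp add: V_def vP P_def r_def)
      show ?thesis
        unfolding T1_def T4_def g\<phi>_def g\<Phi>_def \<Phi>_def r_def[symmetric] P' Z_def Q'
        by (rule flux_identity[OF r_def r P V'])
    qed
    have 2: "T2 x = Q x * (\<psi> x * (lam * v x))"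
      unfolding T2_def \<phi>_def r_def[symmetric] P' Q' vP using P by (simp add: field_simps power2_eq_square)
    have 3: "T3 x = Q x * (\<psi> x * v x powr q)"
    proof -
      \<comment> \<open>Here the choice of \<beta> acts: \<beta> (q - 1) = \<theta> + 2 absorbs the
        weight |x|^\<theta>, so that a pure power of \<open>v\<close> remains.\<close>
      have "P powr q = r powr (\<beta> * (q - 1)) * P" by (simp add: P_def powr_powr algebra_simps flip: powr_add)
      also have "\<dots> = r powr \<theta> * r\<^sup>2 * P" using r by (simp add: \<beta> powr_add)
      finally have "P powr q = r powr \<theta> * r\<^sup>2 * P" .
      moreover have "v x powr q = P powr q * u x powr q"
        using P upos[OF A0(1)[OF x]] by (simp add: vP powr_mult)
      ultimately show ?thesis
        unfolding T3_def \<phi>_def r_def[symmetric] P' Q' using P r by (simp add: field_simps power2_eq_square)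
    qed
    have "T x = (T1 x - T4 x) - T2 x + T3 x" by (simp add: T_def)
    then show ?thesis unfolding 14 2 3 r_def[symmetric] by (simp add: algebra_simps)
  qed
  \<comment> \<open>The zeroth-order coefficient is nonnegative by \<open>lam\<close>, the barrier
    inequality absorbs \<open>\<zeta>1\<close> and \<open>\<zeta>2\<close>, and strictness comes
    from v^q > \<zeta>^q.\<close>
  have bracket: "((n - 2) * \<beta> - \<beta>\<^sup>2 - lam) * v x + v x powr q - (n - 2 - 2 * \<beta>) * \<zeta>1 (t x) - \<zeta>2 (t x) > 0"
    if x: "x \<in> A" and dx: "d x > 0" for x
  proof -
    have "v x > 0" using upos A0[OF x] by (simp add: v_def)
    then have "((n - 2) * \<beta> - \<beta>\<^sup>2 - lam) * v x \<ge> 0" using lam by (simp add: n_def)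
    moreover have "\<zeta> (t x) powr q < v x powr q"
      using dx \<zeta>(3)[OF tR[OF x]] q by (intro powr_less_mono2) (auto simp: d_def)
    ultimately show ?thesis using \<zeta>(4)[OF tR[OF x]] by linarith
  qed
  have Qpos: "Q x > 0" if "x \<in> A" for x using A0[OF that] by (simp add: Q_def)
  \<comment> \<open>Where \<open>d\<close> is not positive, both \<open>\<psi>\<close> and
    \<open>max 0 (d x)\<close> vanish, so the sign of the bracket matters only where
    \<open>d\<close> is positive.\<close>
  have nonneg: "ext T x \<ge> 0" for x
  proof (cases "x \<in> A \<and> d x > 0")
    case True
    then show ?thesis
      using bracket[of x] Qpos[of x] by (simp add: ext_def T_eq \<psi>_def)
  next
    case False
    then show ?thesis by (auto simp: ext_def T_eq \<psi>_def)
  qed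
  have x0A: "x0 \<in> A" using x0 by (simp add: A_def)
  have "ext T x0 = 0"
  proof (rule nonneg_integral_zero_imp_zero[OF _ nonneg zero \<open>open A\<close> _ x0A])
    show "integrable lborel (ext T)" using iT unfolding eT by auto
    have "continuous_on A T" unfolding T_def by (intro continuous_intros cT)
    then show "continuous_on A (ext T)" by (rule continuous_on_eq) (auto simp: ext_def)
  qed
  moreover have "ext T x0 > 0" if "d x0 > 0"
    using bracket[OF x0A that] Qpos[OF x0A] that x0A
    by (auto simp: ext_def T_eq \<psi>_def intro!: mult_pos_pos add_nonneg_pos)
  ultimately have "d x0 \<le> 0" by force
  then show ?thesis by (simp add: d_def v_def t_def)
qed

section \<open>Nonexistence of positive solutions\<close>

theorem theorem1p5:
  fixes q lam \<theta> :: real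
  assumes "CARD('n::finite) \<ge> 3"
    and "q > 1"
    and "lam \<le> lambda_H CARD('n)"
    and "theta_minus CARD('n) lam q \<le> \<theta>"
    and "\<theta> \<le> theta_plus CARD('n) lam q"
  shows "\<not> (\<exists>u :: real ^ 'n \<Rightarrow> real. is_solution lam \<theta> q u)"
proof
  assume "\<exists>u :: real ^ 'n \<Rightarrow> real. is_solution lam \<theta> q u"
  then obtain u :: "real ^ 'n \<Rightarrow> real" where sol: "is_solution lam \<theta> q u" by blast
  \<comment> \<open>The scaling exponent: for u = |x|^(-\<beta>) the Laplacian, the Hardy term and
    |x|^\<theta> u^q all have the same homogeneity.\<close>
  define \<beta> where "\<beta> = (\<theta> + 2) / (q - 1)"
  have \<beta>: "\<beta> * (q - 1) = \<theta> + 2" using assms(2) by (simp add: \<beta>_def)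
  define n where "n = real CARD('n)"
  have "p_minus CARD('n) lam * (q - 1) \<le> \<beta> * (q - 1)" "\<beta> * (q - 1) \<le> p_plus CARD('n) lam * (q - 1)"
    using assms(4,5) by (auto simp: \<beta> theta_minus_def theta_plus_def)
  then have "p_minus CARD('n) lam \<le> \<beta>" "\<beta> \<le> p_plus CARD('n) lam"
    using assms(2) by auto
  \<comment> \<open>\<open>p_minus\<close> and \<open>p_plus\<close> are the roots of s^2 - (N - 2)
    s + lam; squaring the distance of \<beta> to their midpoint gives the sign of this quadratic at
    \<beta>.\<close>
  then have "\<bar>\<beta> - (n - 2) / 2\<bar> \<le> sqrt (lambda_H CARD('n) - lam)"
    by (auto simp: p_minus_def p_plus_def n_def abs_le_iff)
  then have "(\<beta> - (n - 2) / 2)\<^sup>2 \<le> lambda_H CARD('n) - lam"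
    by (rule sqrt_ge_absD)
  then have lam: "lam \<le> (real CARD('n) - 2) * \<beta> - \<beta>\<^sup>2"
    by (simp add: lambda_H_def n_def power2_eq_square field_simps)
  \<comment> \<open>On the unit sphere t = ln |x| = 0, the centre of every interval (-R, R). The
    barrier is then taken with \<delta> = u x, so that its value at 0 lies below \<open>u x\<close>,
    against the comparison.\<close>
  obtain x :: "real ^ 'n" where x: "norm x = 1"
    using vector_choose_size[of 1] by auto
  then have "u x > 0" using sol by (auto simp: is_solution_def)
  then obtain R \<zeta> \<zeta>1 \<zeta>2 where bar: "barrier (real CARD('n) - 2 - 2 * \<beta>) q R \<zeta> \<zeta>1 \<zeta>2"
    and "\<zeta> 0 < u x"
    using barrier_exists[OF assms(2)] by metis
  moreover have "R > 0" using bar by (simp add: barrier_def)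
  ultimately show False
    using subsolution_le_barrier[OF sol assms(2) \<beta> lam bar, of x] x by simp
qed

end
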